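(* Let $q\colon E\to M$ be a tangent display map in a tangent category $(\mathbb X,\mathbb T)$ and let $R\colon TE\to Vq$ be a full vertical connection on $q$. Then there exists a unique horizontal connection $H_R\colon Fq\to TE$ on $q$ such that $(R,H_R)$ is an Ehresmann connection on $q$.
   Context: Composition is diagrammatic: $fg$ is $f$ followed by $g$; $\langle f,g\rangle$ denotes pairing into a (fibred) product, with projections $\pi_1,\pi_2$. A tangent category $(\mathbb X,\mathbb T)$ is a category $\mathbb X$ with an endofunctor $T$ and natural transformations $p_M\colon TM\to M$, $z_M\colon M\to TM$, $s_M\colon T_2M\to TM$, $l_M\colon TM\to T^2M$, $c_M\colon T^2M\to T^2M$, where the $n$-fold pullback $T_nM$ of $p_M$ along itself exists and is preserved by all $T^m$, such that: $(p_M,z_M,s_M)$ is an additive bundle (a commutative monoid in the category over $M$); $(z_M,l_M)\colon p_M\to Tp_M$ and $(\mathrm{id}_{TM},c_M)\colon Tp_M\to p_{TM}$ are additive bundle morphisms (commutative squares preserving zero and sum); $c_Mc_M=\mathrm{id}$, $l_Mc_M=l_M$, $l_M\,Tl_M=l_M\,l_{TM}$, $Tc_M\,c_{TM}\,Tc_M=c_{TM}\,Tc_M\,c_{TM}$, $l_{TM}\,Tc_M\,c_{TM}=c_M\,Tl_M$; and, with $\xi_M=\langle\pi_1l_M,\pi_2z_{TM}\rangle\,Ts_M\colon T_2M\to T^2M$, the square $\xi_M\,Tp_M=\pi_1p_Mz_M$ is a tangent pullback. A tangent pullback is a pullback preserved by $T^m$ for all $m\ge0$. A tangent display map is a morphism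 $q\colon E\to M$ such that for all $n\ge0$ and all $f\colon N\to T^nM$ the pullback of $T^nq$ along $f$ exists and is a tangent pullback. A differential bundle $\mathbf q\colon E\to M$ consists of $q\colon E\to M$, $z_q\colon M\to E$, $s_q\colon E_2\to E$, $l_q\colon E\to TE$ ($E_n$ the $n$-fold pullback of $q$ along itself, required to exist and be preserved by all $T^m$) such that $(q,z_q,s_q)$ is an additive bundle, $(z_M,l_q)\colon q\to Tq$ and $(z_q,l_q)\colon q\to p_E$ are additive bundle morphisms, $l_ql_E=l_q\,Tl_q$, and with $\xi_q=\langle\pi_1l_q,\pi_2z_E\rangle\,Ts_q\colon E_2\to TE$ the square $\xi_q\,Tq=\pi_1qz_M$ is a tangent pullback. Convention: all differential bundles are assumed display, i.e. $q$ is a tangent display map. A morphism $(f,g)\colon\mathbf q\to\mathbf q'$ (with $qf=gq'$) is linear if $g\,l_{q'}=l_q\,Tg$. $\mathbf p_E=(p_E,z_E,s_E,l_E)$ is the tangent bundle. For a tangent display map $q\colon E\to M$: the vertical bundle $\mathbf q^V\colon Vq\to E$ is given by the tangent pullback $Vq$ of $Tq$ along $z_M$, with projections $\iota_q\colon Vq\to TE$ and $T^Vq\colon Vq\to M$; $q^V=\iota_qp_E$, and its zero $z_q^V$, sum $s^V_q$, lift $l_q^V$ are determined by $z_q^V\iota_q=z_E$, $s_q^V\iota_q=(\iota_q\times\iota_q)s_E$, $l_q^V\,T\iota_q=\iota_ql_E$. The Finsler bundle $\mathbf q^F\colon Fq\to E$ is given by the tangent pullback $Fq$ of $q$ along $p_M$,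 with projections $q^F\colon Fq\to E$ and $T^Fq\colon Fq\to TM$, its zero $z_q^F$, sum $s_q^F$, lift $l_q^F$ determined by $z_q^Fq^F=\mathrm{id}_E$, $z_q^F\,T^Fq=qz_M$; $s_q^Fq^F=\pi_1q^F$, $s_q^F\,T^Fq=(T^Fq\times T^Fq)s_M$; $l_q^F\,Tq^F=q^Fz_E$, $l_q^F\,T(T^Fq)=T^Fq\,l_M$. The horizontal descent $\pi_q\colon TE\to Fq$ is the unique morphism with $\pi_qq^F=p_E$ and $\pi_q\,T^Fq=Tq$. A vertical connection on $q$ is $R\colon TE\to Vq$ with $\iota_qR=\mathrm{id}_{Vq}$ and $R\colon\mathbf p_E\to\mathbf q^V$ linear over $E$ ($Rq^V=p_E$, $Rl_q^V=l_E\,TR$). It is full if the commutative square $R\,T^Vq=Tq\,p_M$ (exhibiting $TE$ over $Vq\to M\leftarrow TM$ via $T^Vq$ and $p_M$) is a tangent pullback in $(\mathbb X,\mathbb T)$. A horizontal connection on $q$ is $H\colon Fq\to TE$ with $H\pi_q=\mathrm{id}_{Fq}$ and $H\colon\mathbf q^F\to\mathbf p_E$ linear over $E$ ($Hp_E=q^F$, $Hl_E=l_q^F\,TH$). An Ehresmann connection on $q$ is a pair $(R,H)$ of a vertical and a horizontal connection with $HR=q^Fz_q^V$ and $\langle R\iota_q,\pi_qH\rangle s_E=\mathrm{id}_{TE}$. *)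

theory Defs
  imports Main
begin

section \<open>Categories and pullbacks\<close>

text \<open>
  Composition is diagrammatic: \<open>f \<cdot> g\<close> is \<open>f\<close> followed by \<open>g\<close>.
  Operations are only constrained on objects and on (composable) arrows; their values elsewhere
  are irrelevant.
\<close>

record ('o, 'm) category =
  obj :: "'o set"
  arr :: "'m set"
  src :: "'m \<Rightarrow> 'o"
  trg :: "'m \<Rightarrow> 'o"
  idt :: "'o \<Rightarrow> 'm" ("\<one>\<index>")
  cmp :: "'m \<Rightarrow> 'm \<Rightarrow> 'm" (infixl "\<cdot>\<index>" 70)

definition hom :: "('o, 'm, 'x) category_scheme \<Rightarrow> 'o \<Rightarrow> 'o \<Rightarrow> 'm set" where
  "hom X A B = {f \<in> arr X. src X f = A \<and> trg X f = B}"

locale category =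
  fixes X :: "('o, 'm, 'x) category_scheme" (structure)
  assumes src_obj: "f \<in> arr X \<Longrightarrow> src X f \<in> obj X"
    and trg_obj: "f \<in> arr X \<Longrightarrow> trg X f \<in> obj X"
    and idt_hom: "A \<in> obj X \<Longrightarrow> \<one> A \<in> hom X A A"
    and cmp_hom: "\<lbrakk>f \<in> hom X A B; g \<in> hom X B C\<rbrakk> \<Longrightarrow> f \<cdot> g \<in> hom X A C"
    and idt_left: "f \<in> hom X A B \<Longrightarrow> \<one> A \<cdot> f = f"
    and idt_right: "f \<in> hom X A B \<Longrightarrow> f \<cdot> \<one> B = f"
    and cmp_assoc: "\<lbrakk>f \<in> hom X A B; g \<in> hom X B C; h \<in> hom X C D\<rbrakk> \<Longrightarrow> (f \<cdot> g) \<cdot> h = f \<cdot> (g \<cdot> h)"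

record ('o, 'm) span =
  apex :: 'o
  leg1 :: 'm
  leg2 :: 'm

definition pullback ::
  "('o, 'm, 'x) category_scheme \<Rightarrow> ('o, 'm) span \<Rightarrow> 'm \<Rightarrow> 'm \<Rightarrow> bool" where
  "pullback X P f g \<longleftrightarrow>
     f \<in> arr X \<and> g \<in> arr X \<and> trg X f = trg X g \<and>
     leg1 P \<in> hom X (apex P) (src X f) \<and> leg2 P \<in> hom X (apex P) (src X g) \<and>
     leg1 P \<cdot>\<^bsub>X\<^esub> f = leg2 P \<cdot>\<^bsub>X\<^esub> g \<and>
     (\<forall>A u v. u \<in> hom X A (src X f) \<and> v \<in> hom X A (src X g) \<and> u \<cdot>\<^bsub>X\<^esub> f = v \<cdot>\<^bsub>X\<^esub> g \<longrightarrow>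
        (\<exists>!w. w \<in> hom X A (apex P) \<and> w \<cdot>\<^bsub>X\<^esub> leg1 P = u \<and> w \<cdot>\<^bsub>X\<^esub> leg2 P = v))"

text \<open>The pairing \<open>\<langle>u, v\<rangle>\<close> into the apex of a pullback.\<close>

definition pair ::
  "('o, 'm, 'x) category_scheme \<Rightarrow> ('o, 'm) span \<Rightarrow> 'm \<Rightarrow> 'm \<Rightarrow> 'm" where
  "pair X P u v = (THE w. w \<in> hom X (src X u) (apex P) \<and>
     w \<cdot>\<^bsub>X\<^esub> leg1 P = u \<and> w \<cdot>\<^bsub>X\<^esub> leg2 P = v)"

text \<open>
  \<open>P\<close> with projections \<open>\<pi> i\<close> (\<open>i < n\<close>) is the \<open>n\<close>-fold pullback of \<open>q : E \<rightarrow> M\<close> along itself.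
  The structure map \<open>b : P \<rightarrow> M\<close> is part of the data so that \<open>n = 0\<close> yields \<open>M\<close> itself.
\<close>

definition fibre_power ::
  "('o, 'm, 'x) category_scheme \<Rightarrow> 'm \<Rightarrow> nat \<Rightarrow> 'o \<Rightarrow> 'm \<Rightarrow> (nat \<Rightarrow> 'm) \<Rightarrow> bool" where
  "fibre_power X q n P b \<pi> \<longleftrightarrow>
     q \<in> arr X \<and> b \<in> hom X P (trg X q) \<and>
     (\<forall>i<n. \<pi> i \<in> hom X P (src X q) \<and> \<pi> i \<cdot>\<^bsub>X\<^esub> q = b) \<and>
     (\<forall>A h u. h \<in> hom X A (trg X q) \<and> (\<forall>i<n. u i \<in> hom X A (src X q) \<and> u i \<cdot>\<^bsub>X\<^esub> q = h) \<longrightarrow>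
        (\<exists>!w. w \<in> hom X A P \<and> w \<cdot>\<^bsub>X\<^esub> b = h \<and> (\<forall>i<n. w \<cdot>\<^bsub>X\<^esub> \<pi> i = u i)))"


section \<open>Tangent structures\<close>

text \<open>\<open>T\<^sub>2 M\<close> is a chosen two-fold pullback of the projection, carried as part of the structure.\<close>

record ('o, 'm) tangent = "('o, 'm) category" +
  tobj :: "'o \<Rightarrow> 'o" ("\<T>\<^sub>o\<index>")
  tarr :: "'m \<Rightarrow> 'm" ("\<T>\<index>")
  ttwo :: "'o \<Rightarrow> ('o, 'm) span" ("\<T>\<^sub>2\<index>")
  tprj :: "'o \<Rightarrow> 'm" ("\<^bold>p\<index>")
  tzer :: "'o \<Rightarrow> 'm" ("\<^bold>z\<index>")
  tsum :: "'o \<Rightarrow> 'm" ("\<^bold>s\<index>")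
  tlft :: "'o \<Rightarrow> 'm" ("\<^bold>l\<index>")
  tflp :: "'o \<Rightarrow> 'm" ("\<^bold>c\<index>")

record ('o, 'm) abundle =
  total :: 'o
  base :: 'o
  proj :: 'm
  two :: "('o, 'm) span"
  zero :: 'm
  plus :: 'm

record ('o, 'm) dbundle = "('o, 'm) abundle" +
  lift :: 'm

context
  fixes X :: "('o, 'm) tangent" (structure)
begin

definition tspan :: "('o, 'm) span \<Rightarrow> ('o, 'm) span" where
  "tspan P = \<lparr>apex = \<T>\<^sub>o (apex P), leg1 = \<T> (leg1 P), leg2 = \<T> (leg2 P)\<rparr>"

definition tangent_pullback :: "('o, 'm) span \<Rightarrow> 'm \<Rightarrow> 'm \<Rightarrow> bool" where
  "tangent_pullback P f g \<longleftrightarrow> (\<forall>m. pullback X ((tspan ^^ m) P) ((\<T> ^^ m) f) ((\<T> ^^ m) g))"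

definition tangent_fibre_power :: "'m \<Rightarrow> nat \<Rightarrow> 'o \<Rightarrow> 'm \<Rightarrow> (nat \<Rightarrow> 'm) \<Rightarrow> bool" where
  "tangent_fibre_power q n P b \<pi> \<longleftrightarrow>
     (\<forall>m. fibre_power X ((\<T> ^^ m) q) n ((\<T>\<^sub>o ^^ m) P) ((\<T> ^^ m) b) (\<lambda>i. (\<T> ^^ m) (\<pi> i)))"

text \<open>A commutative monoid in the category over the base.\<close>

definition additive_bundle :: "('o, 'm) abundle \<Rightarrow> bool" where
  "additive_bundle B \<longleftrightarrow>
     proj B \<in> hom X (total B) (base B) \<and>
     pullback X (two B) (proj B) (proj B) \<and>
     zero B \<in> hom X (base B) (total B) \<and>
     zero B \<cdot> proj B = \<one> (base B) \<and>
     plus B \<in> hom X (apex (two B)) (total B) \<and>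
     plus B \<cdot> proj B = leg1 (two B) \<cdot> proj B \<and>
     pair X (two B) (\<one> (total B)) (proj B \<cdot> zero B) \<cdot> plus B = \<one> (total B) \<and>
     pair X (two B) (proj B \<cdot> zero B) (\<one> (total B)) \<cdot> plus B = \<one> (total B) \<and>
     pair X (two B) (leg2 (two B)) (leg1 (two B)) \<cdot> plus B = plus B \<and>
     (\<forall>P b \<pi>. fibre_power X (proj B) 3 P b \<pi> \<longrightarrow>
        pair X (two B) (pair X (two B) (\<pi> 0) (\<pi> 1) \<cdot> plus B) (\<pi> 2) \<cdot> plus B =
        pair X (two B) (\<pi> 0) (pair X (two B) (\<pi> 1) (\<pi> 2) \<cdot> plus B) \<cdot> plus B)"

definition additive_morphism :: "('o, 'm) abundle \<Rightarrow> ('o, 'm) abundle \<Rightarrow> 'm \<Rightarrow> 'm \<Rightarrow> bool" where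
  "additive_morphism B B' f g \<longleftrightarrow>
     f \<in> hom X (base B) (base B') \<and> g \<in> hom X (total B) (total B') \<and>
     proj B \<cdot> f = g \<cdot> proj B' \<and>
     zero B \<cdot> g = f \<cdot> zero B' \<and>
     plus B \<cdot> g = pair X (two B') (leg1 (two B) \<cdot> g) (leg2 (two B) \<cdot> g) \<cdot> plus B'"

definition tangent_abundle :: "'o \<Rightarrow> ('o, 'm) abundle" where
  "tangent_abundle M = \<lparr>total = \<T>\<^sub>o M, base = M, proj = \<^bold>p M, two = \<T>\<^sub>2 M, zero = \<^bold>z M, plus = \<^bold>s M\<rparr>"

definition tabundle :: "('o, 'm) abundle \<Rightarrow> ('o, 'm) abundle" where
  "tabundle B = \<lparr>total = \<T>\<^sub>o (total B), base = \<T>\<^sub>o (base B), proj = \<T> (proj B),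
     two = tspan (two B), zero = \<T> (zero B), plus = \<T> (plus B)\<rparr>"

text \<open>
  The map \<open>\<xi> : T\<^sub>2 M \<rightarrow> T\<^sup>2 M\<close> whose square over the zero section is required to be a tangent pullback;
  the pairing is into \<open>T (T\<^sub>2 M)\<close>, the pullback of \<open>T p\<close> along itself.
\<close>

definition xi :: "'o \<Rightarrow> 'm" where
  "xi M = pair X (tspan (\<T>\<^sub>2 M)) (leg1 (\<T>\<^sub>2 M) \<cdot> \<^bold>l M) (leg2 (\<T>\<^sub>2 M) \<cdot> \<^bold>z (\<T>\<^sub>o M)) \<cdot> \<T> (\<^bold>s M)"

end

locale tangent_category = category X for X :: "('o, 'm) tangent" (structure) +
  assumes tobj_obj: "M \<in> obj X \<Longrightarrow> \<T>\<^sub>o M \<in> obj X"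
    and tarr_hom: "f \<in> hom X M N \<Longrightarrow> \<T> f \<in> hom X (\<T>\<^sub>o M) (\<T>\<^sub>o N)"
    and tarr_idt: "M \<in> obj X \<Longrightarrow> \<T> (\<one> M) = \<one> (\<T>\<^sub>o M)"
    and tarr_cmp: "\<lbrakk>f \<in> hom X L M; g \<in> hom X M N\<rbrakk> \<Longrightarrow> \<T> (f \<cdot> g) = \<T> f \<cdot> \<T> g"

    and fibre_powers: "M \<in> obj X \<Longrightarrow> \<exists>P b \<pi>. tangent_fibre_power X (\<^bold>p M) n P b \<pi>"
    and two_pullback: "M \<in> obj X \<Longrightarrow> tangent_pullback X (\<T>\<^sub>2 M) (\<^bold>p M) (\<^bold>p M)"

    and prj_hom: "M \<in> obj X \<Longrightarrow> \<^bold>p M \<in> hom X (\<T>\<^sub>o M) M"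
    and zer_hom: "M \<in> obj X \<Longrightarrow> \<^bold>z M \<in> hom X M (\<T>\<^sub>o M)"
    and sum_hom: "M \<in> obj X \<Longrightarrow> \<^bold>s M \<in> hom X (apex (\<T>\<^sub>2 M)) (\<T>\<^sub>o M)"
    and lft_hom: "M \<in> obj X \<Longrightarrow> \<^bold>l M \<in> hom X (\<T>\<^sub>o M) (\<T>\<^sub>o (\<T>\<^sub>o M))"
    and flp_hom: "M \<in> obj X \<Longrightarrow> \<^bold>c M \<in> hom X (\<T>\<^sub>o (\<T>\<^sub>o M)) (\<T>\<^sub>o (\<T>\<^sub>o M))"

    and prj_natural: "f \<in> hom X M N \<Longrightarrow> \<T> f \<cdot> \<^bold>p N = \<^bold>p M \<cdot> f"
    and zer_natural: "f \<in> hom X M N \<Longrightarrow> f \<cdot> \<^bold>z N = \<^bold>z M \<cdot> \<T> f"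
    and sum_natural: "f \<in> hom X M N \<Longrightarrow>
      pair X (\<T>\<^sub>2 N) (leg1 (\<T>\<^sub>2 M) \<cdot> \<T> f) (leg2 (\<T>\<^sub>2 M) \<cdot> \<T> f) \<cdot> \<^bold>s N = \<^bold>s M \<cdot> \<T> f"
    and lft_natural: "f \<in> hom X M N \<Longrightarrow> \<T> f \<cdot> \<^bold>l N = \<^bold>l M \<cdot> \<T> (\<T> f)"
    and flp_natural: "f \<in> hom X M N \<Longrightarrow> \<T> (\<T> f) \<cdot> \<^bold>c N = \<^bold>c M \<cdot> \<T> (\<T> f)"

    and tangent_additive: "M \<in> obj X \<Longrightarrow> additive_bundle X (tangent_abundle X M)"
    and lft_additive: "M \<in> obj X \<Longrightarrow>
      additive_morphism X (tangent_abundle X M) (tabundle X (tangent_abundle X M)) (\<^bold>z M) (\<^bold>l M)"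
    and flp_additive: "M \<in> obj X \<Longrightarrow>
      additive_morphism X (tabundle X (tangent_abundle X M)) (tangent_abundle X (\<T>\<^sub>o M))
        (\<one> (\<T>\<^sub>o M)) (\<^bold>c M)"

    and flp_flp: "M \<in> obj X \<Longrightarrow> \<^bold>c M \<cdot> \<^bold>c M = \<one> (\<T>\<^sub>o (\<T>\<^sub>o M))"
    and lft_flp: "M \<in> obj X \<Longrightarrow> \<^bold>l M \<cdot> \<^bold>c M = \<^bold>l M"
    and lft_lft: "M \<in> obj X \<Longrightarrow> \<^bold>l M \<cdot> \<T> (\<^bold>l M) = \<^bold>l M \<cdot> \<^bold>l (\<T>\<^sub>o M)"
    and flp_braid: "M \<in> obj X \<Longrightarrow>
      \<T> (\<^bold>c M) \<cdot> \<^bold>c (\<T>\<^sub>o M) \<cdot> \<T> (\<^bold>c M) = \<^bold>c (\<T>\<^sub>o M) \<cdot> \<T> (\<^bold>c M) \<cdot> \<^bold>c (\<T>\<^sub>o M)"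
    and lft_flp_flp: "M \<in> obj X \<Longrightarrow>
      \<^bold>l (\<T>\<^sub>o M) \<cdot> \<T> (\<^bold>c M) \<cdot> \<^bold>c (\<T>\<^sub>o M) = \<^bold>c M \<cdot> \<T> (\<^bold>l M)"
    and lft_universal: "M \<in> obj X \<Longrightarrow>
      tangent_pullback X \<lparr>apex = apex (\<T>\<^sub>2 M), leg1 = xi X M, leg2 = leg1 (\<T>\<^sub>2 M) \<cdot> \<^bold>p M\<rparr>
        (\<T> (\<^bold>p M)) (\<^bold>z M)"


section \<open>Display maps, vertical and Finsler bundles\<close>

context
  fixes X :: "('o, 'm) tangent" (structure)
begin

definition tangent_display_map :: "'m \<Rightarrow> bool" where
  "tangent_display_map q \<longleftrightarrow> q \<in> arr X \<and>
     (\<forall>n N f. f \<in> hom X N ((\<T>\<^sub>o ^^ n) (trg X q)) \<longrightarrow> (\<exists>P. tangent_pullback X P ((\<T> ^^ n) q) f))"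

definition tangent_bundle :: "'o \<Rightarrow> ('o, 'm) dbundle" where
  "tangent_bundle M = \<lparr>total = \<T>\<^sub>o M, base = M, proj = \<^bold>p M, two = \<T>\<^sub>2 M,
     zero = \<^bold>z M, plus = \<^bold>s M, lift = \<^bold>l M\<rparr>"

definition linear_morphism :: "('o, 'm) dbundle \<Rightarrow> ('o, 'm) dbundle \<Rightarrow> 'm \<Rightarrow> 'm \<Rightarrow> bool" where
  "linear_morphism B B' f g \<longleftrightarrow>
     f \<in> hom X (base B) (base B') \<and> g \<in> hom X (total B) (total B') \<and>
     proj B \<cdot> f = g \<cdot> proj B' \<and> g \<cdot> lift B' = lift B \<cdot> \<T> g"

text \<open>
  The pullbacks \<open>V q\<close> and \<open>F q\<close> are passed as arguments, so that everything below is stated for an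
  arbitrary choice of them. \<open>V q\<close> has legs \<open>\<iota>\<close> and \<open>T\<^sup>V q\<close>; \<open>F q\<close> has legs \<open>q\<^sup>F\<close> and \<open>T\<^sup>F q\<close>.
\<close>

definition vertical_pullback :: "'m \<Rightarrow> ('o, 'm) span \<Rightarrow> bool" where
  "vertical_pullback q V \<longleftrightarrow> tangent_pullback X V (\<T> q) (\<^bold>z (trg X q))"

definition finsler_pullback :: "'m \<Rightarrow> ('o, 'm) span \<Rightarrow> bool" where
  "finsler_pullback q F \<longleftrightarrow> tangent_pullback X F q (\<^bold>p (trg X q))"

text \<open>
  A chosen two-fold pullback, used as the domain of the sum of the vertical and Finsler bundles.
\<close>

definition chosen_two :: "'m \<Rightarrow> ('o, 'm) span" where
  "chosen_two q = (SOME P. tangent_pullback X P q q)"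

text \<open>
  The leg \<open>\<iota>\<close> is monic, being a pullback of the split monomorphism \<open>z\<close>, and so is \<open>T \<iota>\<close>; hence
  the defining equations determine the structure maps.
\<close>

definition vertical_bundle :: "'m \<Rightarrow> ('o, 'm) span \<Rightarrow> ('o, 'm) dbundle" where
  "vertical_bundle q V =
     (let E = src X q; \<iota> = leg1 V; qV = \<iota> \<cdot> \<^bold>p E; V2 = chosen_two qV in
      \<lparr>total = apex V, base = E, proj = qV, two = V2,
       zero = (THE f. f \<in> hom X E (apex V) \<and> f \<cdot> \<iota> = \<^bold>z E),
       plus = (THE f. f \<in> hom X (apex V2) (apex V) \<and>
         f \<cdot> \<iota> = pair X (\<T>\<^sub>2 E) (leg1 V2 \<cdot> \<iota>) (leg2 V2 \<cdot> \<iota>) \<cdot> \<^bold>s E),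
       lift = (THE f. f \<in> hom X (apex V) (\<T>\<^sub>o (apex V)) \<and> f \<cdot> \<T> \<iota> = \<iota> \<cdot> \<^bold>l E)\<rparr>)"

definition finsler_bundle :: "'m \<Rightarrow> ('o, 'm) span \<Rightarrow> ('o, 'm) dbundle" where
  "finsler_bundle q F =
     (let E = src X q; M = trg X q; qF = leg1 F; TFq = leg2 F; F2 = chosen_two qF in
      \<lparr>total = apex F, base = E, proj = qF, two = F2,
       zero = pair X F (\<one> E) (q \<cdot> \<^bold>z M),
       plus = pair X F (leg1 F2 \<cdot> qF)
         (pair X (\<T>\<^sub>2 M) (leg1 F2 \<cdot> TFq) (leg2 F2 \<cdot> TFq) \<cdot> \<^bold>s M),
       lift = pair X (tspan X F) (qF \<cdot> \<^bold>z E) (TFq \<cdot> \<^bold>l M)\<rparr>)"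

definition horizontal_descent :: "'m \<Rightarrow> ('o, 'm) span \<Rightarrow> 'm" where
  "horizontal_descent q F = pair X F (\<^bold>p (src X q)) (\<T> q)"


section \<open>Connections\<close>

definition vertical_connection :: "'m \<Rightarrow> ('o, 'm) span \<Rightarrow> 'm \<Rightarrow> bool" where
  "vertical_connection q V R \<longleftrightarrow>
     R \<in> hom X (\<T>\<^sub>o (src X q)) (apex V) \<and>
     leg1 V \<cdot> R = \<one> (apex V) \<and>
     linear_morphism (tangent_bundle (src X q)) (vertical_bundle q V) (\<one> (src X q)) R"

definition full_vertical_connection :: "'m \<Rightarrow> ('o, 'm) span \<Rightarrow> 'm \<Rightarrow> bool" where
  "full_vertical_connection q V R \<longleftrightarrow>
     vertical_connection q V R \<and>
     tangent_pullback X \<lparr>apex = \<T>\<^sub>o (src X q), leg1 = R, leg2 = \<T> q\<rparr> (leg2 V) (\<^bold>p (trg X q))"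

definition horizontal_connection :: "'m \<Rightarrow> ('o, 'm) span \<Rightarrow> 'm \<Rightarrow> bool" where
  "horizontal_connection q F H \<longleftrightarrow>
     H \<in> hom X (apex F) (\<T>\<^sub>o (src X q)) \<and>
     H \<cdot> horizontal_descent q F = \<one> (apex F) \<and>
     linear_morphism (finsler_bundle q F) (tangent_bundle (src X q)) (\<one> (src X q)) H"

definition ehresmann_connection ::
  "'m \<Rightarrow> ('o, 'm) span \<Rightarrow> ('o, 'm) span \<Rightarrow> 'm \<Rightarrow> 'm \<Rightarrow> bool" where
  "ehresmann_connection q V F R H \<longleftrightarrow>
     vertical_connection q V R \<and> horizontal_connection q F H \<and>
     H \<cdot> R = leg1 F \<cdot> zero (vertical_bundle q V) \<and>
     pair X (\<T>\<^sub>2 (src X q)) (R \<cdot> leg1 V) (horizontal_descent q F \<cdot> H) \<cdot> \<^bold>s (src X q) =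
       \<one> (\<T>\<^sub>o (src X q))"

end

end

theory Submission
  imports Defs
begin

text \<open>
  Write \<open>\<iota>, \<tau>\<close> for the legs of \<open>V q\<close> and \<open>q\<^sup>F, \<phi>\<close> for those of \<open>F q\<close>. Fullness says that a tangent
  vector of \<open>E\<close> is the same as a pair of its value under \<open>R\<close> and its value under \<open>T q\<close>. The first
  Ehresmann equation prescribes \<open>H R = q\<^sup>F z\<^sub>V\<close>, and being a section of the horizontal descent forces
  \<open>H (T q) = \<phi>\<close>. These two maps agree over \<open>M\<close>, so there is exactly one candidate \<open>H\<close>; this is
  uniqueness. This \<open>H\<close> lies over \<open>E\<close> because \<open>R\<close> does; that it is a section of the descent and linear
  is checked on the legs of pullbacks, which for linearity is the image under \<open>T\<close> of the fullness
  square (lemma \<open>H_linear\<close>).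

  The decomposition of a tangent vector into the sum of a vertical and a horizontal part is again
  checked on the legs \<open>R\<close> and \<open>T q\<close>. On \<open>T q\<close> it follows from naturality of the sum. On \<open>R\<close> it needs
  \<open>R\<close> to preserve sums, whereas \<open>R\<close> is only given as a linear map. Since \<open>\<iota>\<close> is monic and the
  structure of \<open>V q\<close> is inherited along \<open>\<iota>\<close>, it suffices to treat the linear endomorphism \<open>R \<iota>\<close> of the
  tangent bundle of \<open>E\<close>. Linear endomorphisms \<open>e\<close> are additive (lemma \<open>linear_imp_additive\<close>): \<open>e l = l (T e)\<close>,
  and both \<open>l\<close> and \<open>T e\<close> are additive for the sum of \<open>T (T E)\<close> over \<open>T E\<close>, so that the two sums to be
  compared agree after composition with \<open>l\<close>, which is monic by universality of the lift
  (lemma \<open>lft_monic\<close>).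
\<close>

section \<open>Composition and pairing\<close>

context category
begin

lemma homI: "\<lbrakk>f \<in> arr X; src X f = A; trg X f = B\<rbrakk> \<Longrightarrow> f \<in> hom X A B"
  by (simp add: hom_def)

lemma homD: "f \<in> hom X A B \<Longrightarrow> f \<in> arr X \<and> src X f = A \<and> trg X f = B \<and> A \<in> obj X \<and> B \<in> obj X"
  using src_obj trg_obj by (auto simp: hom_def)

lemma cmp_arr [simp]:
  assumes "f \<in> arr X" "g \<in> arr X" "trg X f = src X g"
  shows "f \<cdot> g \<in> arr X" "src X (f \<cdot> g) = src X f" "trg X (f \<cdot> g) = trg X g"
  using cmp_hom[of f "src X f" "trg X f" g "trg X g"] assms by (auto simp: hom_def)

lemma idt_arr [simp]:
  assumes "A \<in> obj X"
  shows "\<one> A \<in> arr X" "src X (\<one> A) = A" "trg X (\<one> A) = A"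
  using idt_hom[OF assms] by (auto simp: hom_def)

lemma cmp_idt_left [simp]: "\<lbrakk>f \<in> arr X; src X f = A\<rbrakk> \<Longrightarrow> \<one> A \<cdot> f = f"
  using idt_left[of f A "trg X f"] by (simp add: hom_def)

lemma cmp_idt_right [simp]: "\<lbrakk>f \<in> arr X; trg X f = A\<rbrakk> \<Longrightarrow> f \<cdot> \<one> A = f"
  using idt_right[of f "src X f" A] by (simp add: hom_def)

lemma assoc:
  "\<lbrakk>f \<in> arr X; g \<in> arr X; h \<in> arr X; trg X f = src X g; trg X g = src X h\<rbrakk>
    \<Longrightarrow> (f \<cdot> g) \<cdot> h = f \<cdot> (g \<cdot> h)"
  using cmp_assoc[of f "src X f" "trg X f" g "trg X g" h "trg X h"] by (simp add: hom_def)

text \<open>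
  Lets an equation between two-fold composites rewrite the front of a longer composite that has
  been associated to the right.
\<close>

lemma rewrite_prefix:
  assumes "f \<cdot> g = f' \<cdot> g'"
    and "f \<in> arr X" "g \<in> arr X" "trg X f = src X g"
    and "f' \<in> arr X" "g' \<in> arr X" "trg X f' = src X g'"
    and "h \<in> arr X" "trg X g = src X h" "trg X g' = src X h"
  shows "f \<cdot> (g \<cdot> h) = f' \<cdot> (g' \<cdot> h)"
  using assms assoc[of f g h] assoc[of f' g' h] by simp

lemma pullback_square:
  assumes "pullback X P f g"
  shows "f \<in> arr X" "g \<in> arr X" "trg X f = trg X g" "leg1 P \<in> arr X" "leg2 P \<in> arr X"
    "src X (leg1 P) = apex P" "src X (leg2 P) = apex P" "apex P \<in> obj X"
    "trg X (leg1 P) = src X f" "trg X (leg2 P) = src X g" "leg1 P \<cdot> f = leg2 P \<cdot> g"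
proof -
  have leg: "leg1 P \<in> hom X (apex P) (src X f)" using assms by (simp add: pullback_def)
  show "apex P \<in> obj X" using homD[OF leg] by simp
qed (use assms in \<open>auto simp: pullback_def hom_def\<close>)

lemma pullback_jointly_monic:
  assumes P: "pullback X P f g"
    and w: "w \<in> hom X A (apex P)" "w' \<in> hom X A (apex P)"
    and eq: "w \<cdot> leg1 P = w' \<cdot> leg1 P" "w \<cdot> leg2 P = w' \<cdot> leg2 P"
  shows "w = w'"
proof -
  note sq = pullback_square[OF P]
  have "w \<cdot> leg1 P \<in> hom X A (src X f)" "w \<cdot> leg2 P \<in> hom X A (src X g)"
    "(w \<cdot> leg1 P) \<cdot> f = (w \<cdot> leg2 P) \<cdot> g"
    using w sq by (auto simp: hom_def assoc)
  then have "\<exists>!v. v \<in> hom X A (apex P) \<and> v \<cdot> leg1 P = w \<cdot> leg1 P \<and> v \<cdot> leg2 P = w \<cdot> leg2 P"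
    using P unfolding pullback_def by blast
  then show ?thesis using w eq by metis
qed

lemma pair_into_pullback:
  assumes P: "pullback X P f g"
    and u: "u \<in> hom X A (src X f)" and v: "v \<in> hom X A (src X g)" and eq: "u \<cdot> f = v \<cdot> g"
  shows "pair X P u v \<in> hom X A (apex P)"
    and "pair X P u v \<cdot> leg1 P = u" and "pair X P u v \<cdot> leg2 P = v"
proof -
  have A: "src X u = A" using homD[OF u] by simp
  have "\<exists>!w. w \<in> hom X (src X u) (apex P) \<and> w \<cdot> leg1 P = u \<and> w \<cdot> leg2 P = v"
    unfolding A using P u v eq unfolding pullback_def by blast
  from theI'[OF this] A
  show "pair X P u v \<in> hom X A (apex P)"
    and "pair X P u v \<cdot> leg1 P = u" and "pair X P u v \<cdot> leg2 P = v"
    unfolding pair_def by simp_all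
qed

lemma pair_unique:
  assumes P: "pullback X P f g" and w: "w \<in> hom X A (apex P)"
  shows "pair X P (w \<cdot> leg1 P) (w \<cdot> leg2 P) = w"
proof -
  note sq = pullback_square[OF P]
  have "w \<cdot> leg1 P \<in> hom X A (src X f)" "w \<cdot> leg2 P \<in> hom X A (src X g)"
    "(w \<cdot> leg1 P) \<cdot> f = (w \<cdot> leg2 P) \<cdot> g"
    using w sq by (auto simp: hom_def assoc)
  from pair_into_pullback[OF P this] show ?thesis
    using pullback_jointly_monic[OF P _ w] by blast
qed

lemma cmp_pair:
  assumes P: "pullback X P f g"
    and u: "u \<in> hom X A (src X f)" and v: "v \<in> hom X A (src X g)" and eq: "u \<cdot> f = v \<cdot> g"
    and h: "h \<in> hom X B A"
  shows "h \<cdot> pair X P u v = pair X P (h \<cdot> u) (h \<cdot> v)"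
proof -
  note pr = pair_into_pullback[OF P u v eq]
  have "h \<cdot> pair X P u v \<in> hom X B (apex P)" using cmp_hom[OF h pr(1)] .
  from pair_unique[OF P this] show ?thesis
    using h pr pullback_square[OF P] by (auto simp: hom_def assoc)
qed

end


section \<open>Sums of tangent vectors\<close>

context tangent_category
begin

lemma tarr_arr [simp]:
  assumes "f \<in> arr X"
  shows "\<T> f \<in> arr X" "src X (\<T> f) = \<T>\<^sub>o (src X f)" "trg X (\<T> f) = \<T>\<^sub>o (trg X f)"
  using tarr_hom[of f "src X f" "trg X f"] assms by (auto simp: hom_def)

lemma tarr_composite:
  "\<lbrakk>f \<in> arr X; g \<in> arr X; trg X f = src X g\<rbrakk> \<Longrightarrow> \<T> (f \<cdot> g) = \<T> f \<cdot> \<T> g"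
  using tarr_cmp[of f "src X f" "trg X f" g "trg X g"] by (simp add: hom_def)

declare tobj_obj [simp]

lemma structure_arr [simp]:
  assumes "M \<in> obj X"
  shows "\<^bold>p M \<in> arr X" "src X (\<^bold>p M) = \<T>\<^sub>o M" "trg X (\<^bold>p M) = M"
    "\<^bold>z M \<in> arr X" "src X (\<^bold>z M) = M" "trg X (\<^bold>z M) = \<T>\<^sub>o M"
    "\<^bold>s M \<in> arr X" "src X (\<^bold>s M) = apex (\<T>\<^sub>2 M)" "trg X (\<^bold>s M) = \<T>\<^sub>o M"
    "\<^bold>l M \<in> arr X" "src X (\<^bold>l M) = \<T>\<^sub>o M" "trg X (\<^bold>l M) = \<T>\<^sub>o (\<T>\<^sub>o M)"
    "\<^bold>c M \<in> arr X" "src X (\<^bold>c M) = \<T>\<^sub>o (\<T>\<^sub>o M)" "trg X (\<^bold>c M) = \<T>\<^sub>o (\<T>\<^sub>o M)"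
  using prj_hom[OF assms] zer_hom[OF assms] sum_hom[OF assms] lft_hom[OF assms] flp_hom[OF assms]
  by (auto simp: hom_def)

lemma tangent_pullback_pullback: "tangent_pullback X P f g \<Longrightarrow> pullback X P f g"
  unfolding tangent_pullback_def by (drule spec[of _ 0]) simp

lemma tangent_pullback_tspan: "tangent_pullback X P f g \<Longrightarrow> pullback X (tspan X P) (\<T> f) (\<T> g)"
  unfolding tangent_pullback_def by (drule spec[of _ 1]) simp

lemma tspan_sel [simp]:
  "apex (tspan X P) = \<T>\<^sub>o (apex P)" "leg1 (tspan X P) = \<T> (leg1 P)" "leg2 (tspan X P) = \<T> (leg2 P)"
  by (simp_all add: tspan_def)

lemmas two_pb = tangent_pullback_pullback[OF two_pullback]
  and Ttwo_pb = tangent_pullback_tspan[OF two_pullback]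

lemma two_legs [simp]:
  assumes "M \<in> obj X"
  shows "leg1 (\<T>\<^sub>2 M) \<in> arr X" "src X (leg1 (\<T>\<^sub>2 M)) = apex (\<T>\<^sub>2 M)" "trg X (leg1 (\<T>\<^sub>2 M)) = \<T>\<^sub>o M"
    "leg2 (\<T>\<^sub>2 M) \<in> arr X" "src X (leg2 (\<T>\<^sub>2 M)) = apex (\<T>\<^sub>2 M)" "trg X (leg2 (\<T>\<^sub>2 M)) = \<T>\<^sub>o M"
    "apex (\<T>\<^sub>2 M) \<in> obj X"
  using pullback_square[OF two_pb[OF assms]] assms by auto

lemma two_legs_square: "M \<in> obj X \<Longrightarrow> leg1 (\<T>\<^sub>2 M) \<cdot> \<^bold>p M = leg2 (\<T>\<^sub>2 M) \<cdot> \<^bold>p M"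
  using pullback_square(11)[OF two_pb] .

lemma zer_prj: "M \<in> obj X \<Longrightarrow> \<^bold>z M \<cdot> \<^bold>p M = \<one> M"
  using tangent_additive[of M] by (simp add: additive_bundle_def tangent_abundle_def)

lemma zer_lft: "M \<in> obj X \<Longrightarrow> \<^bold>z M \<cdot> \<^bold>l M = \<^bold>z M \<cdot> \<T> (\<^bold>z M)"
  using lft_additive[of M] by (simp add: additive_morphism_def tangent_abundle_def tabundle_def)

lemma lft_tprj: "M \<in> obj X \<Longrightarrow> \<^bold>l M \<cdot> \<T> (\<^bold>p M) = \<^bold>p M \<cdot> \<^bold>z M"
  using lft_additive[of M] by (simp add: additive_morphism_def tangent_abundle_def tabundle_def)

lemma flp_prj: "M \<in> obj X \<Longrightarrow> \<^bold>c M \<cdot> \<^bold>p (\<T>\<^sub>o M) = \<T> (\<^bold>p M)"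
  using flp_additive[of M] by (simp add: additive_morphism_def tangent_abundle_def tabundle_def)

lemma lft_prj:
  assumes "M \<in> obj X"
  shows "\<^bold>l M \<cdot> \<^bold>p (\<T>\<^sub>o M) = \<^bold>p M \<cdot> \<^bold>z M"
proof -
  have "\<^bold>l M \<cdot> \<^bold>p (\<T>\<^sub>o M) = (\<^bold>l M \<cdot> \<^bold>c M) \<cdot> \<^bold>p (\<T>\<^sub>o M)"
    using assms by (simp add: lft_flp)
  also have "\<dots> = \<^bold>l M \<cdot> \<T> (\<^bold>p M)"
    using assms by (simp add: assoc flp_prj)
  finally show ?thesis using assms by (simp add: lft_tprj)
qed

definition vec_add :: "'o \<Rightarrow> 'm \<Rightarrow> 'm \<Rightarrow> 'm" where
  "vec_add M a b = pair X (\<T>\<^sub>2 M) a b \<cdot> \<^bold>s M"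

text \<open>
  The precondition for adding generalized elements \<open>a, b : A \<rightarrow> T M\<close>, typing included; it is what
  makes the pairing in \<open>vec_add\<close> meaningful.
\<close>

definition same_fibre :: "'o \<Rightarrow> 'o \<Rightarrow> 'm \<Rightarrow> 'm \<Rightarrow> bool" where
  "same_fibre A M a b \<longleftrightarrow> M \<in> obj X \<and> a \<in> hom X A (\<T>\<^sub>o M) \<and> b \<in> hom X A (\<T>\<^sub>o M) \<and> a \<cdot> \<^bold>p M = b \<cdot> \<^bold>p M"

lemma same_fibre_pair:
  assumes "same_fibre A M a b"
  shows "pair X (\<T>\<^sub>2 M) a b \<in> hom X A (apex (\<T>\<^sub>2 M))"
    "pair X (\<T>\<^sub>2 M) a b \<cdot> leg1 (\<T>\<^sub>2 M) = a" "pair X (\<T>\<^sub>2 M) a b \<cdot> leg2 (\<T>\<^sub>2 M) = b"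
  using assms pair_into_pullback[OF two_pb, of M a A b] unfolding same_fibre_def by auto

lemma vec_add_hom: "same_fibre A M a b \<Longrightarrow> vec_add M a b \<in> hom X A (\<T>\<^sub>o M)"
  using same_fibre_pair(1) unfolding vec_add_def same_fibre_def by (metis cmp_hom sum_hom)

lemma cmp_vec_add:
  assumes ab: "same_fibre A M a b" and h: "h \<in> hom X B A"
  shows "h \<cdot> vec_add M a b = vec_add M (h \<cdot> a) (h \<cdot> b)"
proof -
  note pr = same_fibre_pair[OF ab]
  have M: "M \<in> obj X" and "a \<in> hom X A (\<T>\<^sub>o M)" "b \<in> hom X A (\<T>\<^sub>o M)" "a \<cdot> \<^bold>p M = b \<cdot> \<^bold>p M"
    using ab by (auto simp: same_fibre_def)
  then have "h \<cdot> pair X (\<T>\<^sub>2 M) a b = pair X (\<T>\<^sub>2 M) (h \<cdot> a) (h \<cdot> b)"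
    by (intro cmp_pair[OF two_pb[OF M] _ _ _ h]) auto
  moreover have "h \<cdot> (pair X (\<T>\<^sub>2 M) a b \<cdot> \<^bold>s M) = (h \<cdot> pair X (\<T>\<^sub>2 M) a b) \<cdot> \<^bold>s M"
    using h pr(1) M by (subst assoc) (auto simp: hom_def)
  ultimately show ?thesis by (simp add: vec_add_def)
qed

lemma vec_add_zero:
  assumes M: "M \<in> obj X" and a: "a \<in> hom X A (\<T>\<^sub>o M)"
  shows "vec_add M a (a \<cdot> (\<^bold>p M \<cdot> \<^bold>z M)) = a" and "vec_add M (a \<cdot> (\<^bold>p M \<cdot> \<^bold>z M)) a = a"
proof -
  have unit: "vec_add M (\<one> (\<T>\<^sub>o M)) (\<^bold>p M \<cdot> \<^bold>z M) = \<one> (\<T>\<^sub>o M)"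
    "vec_add M (\<^bold>p M \<cdot> \<^bold>z M) (\<one> (\<T>\<^sub>o M)) = \<one> (\<T>\<^sub>o M)"
    using tangent_additive[OF M] by (simp_all add: additive_bundle_def tangent_abundle_def vec_add_def)
  have fib: "same_fibre (\<T>\<^sub>o M) M (\<one> (\<T>\<^sub>o M)) (\<^bold>p M \<cdot> \<^bold>z M)"
    "same_fibre (\<T>\<^sub>o M) M (\<^bold>p M \<cdot> \<^bold>z M) (\<one> (\<T>\<^sub>o M))"
    using M by (auto simp: same_fibre_def assoc zer_prj intro!: homI)
  show "vec_add M a (a \<cdot> (\<^bold>p M \<cdot> \<^bold>z M)) = a" "vec_add M (a \<cdot> (\<^bold>p M \<cdot> \<^bold>z M)) a = a"
    using cmp_vec_add[OF fib(1) a] cmp_vec_add[OF fib(2) a] a unit by (auto simp: hom_def)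
qed

text \<open>
  Since every pair of vectors in one fibre factors through the two projections of \<open>T\<^sub>2 M\<close>, a map
  that adds those projections adds all vectors.
\<close>

lemma preserves_vec_addI:
  assumes M: "M \<in> obj X" and N: "N \<in> obj X" and g: "g \<in> hom X (\<T>\<^sub>o M) (\<T>\<^sub>o N)"
    and fib: "leg1 (\<T>\<^sub>2 M) \<cdot> g \<cdot> \<^bold>p N = leg2 (\<T>\<^sub>2 M) \<cdot> g \<cdot> \<^bold>p N"
    and univ: "\<^bold>s M \<cdot> g = vec_add N (leg1 (\<T>\<^sub>2 M) \<cdot> g) (leg2 (\<T>\<^sub>2 M) \<cdot> g)"
    and ab: "same_fibre A M a b"
  shows "vec_add M a b \<cdot> g = vec_add N (a \<cdot> g) (b \<cdot> g)"
    and "same_fibre A N (a \<cdot> g) (b \<cdot> g)"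
proof -
  note pr = same_fibre_pair[OF ab]
  let ?w = "pair X (\<T>\<^sub>2 M) a b"
  have legs: "?w \<cdot> (leg1 (\<T>\<^sub>2 M) \<cdot> g) = a \<cdot> g" "?w \<cdot> (leg2 (\<T>\<^sub>2 M) \<cdot> g) = b \<cdot> g"
    using pr g M assoc[of ?w "leg1 (\<T>\<^sub>2 M)" g] assoc[of ?w "leg2 (\<T>\<^sub>2 M)" g]
    by (auto simp: hom_def)
  have fib': "same_fibre (apex (\<T>\<^sub>2 M)) N (leg1 (\<T>\<^sub>2 M) \<cdot> g) (leg2 (\<T>\<^sub>2 M) \<cdot> g)"
    using M N g fib by (auto simp: same_fibre_def hom_def)
  have "vec_add M a b \<cdot> g = ?w \<cdot> (\<^bold>s M \<cdot> g)"
    unfolding vec_add_def using pr(1) M g by (subst assoc) (auto simp: hom_def)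
  also have "\<dots> = vec_add N (?w \<cdot> (leg1 (\<T>\<^sub>2 M) \<cdot> g)) (?w \<cdot> (leg2 (\<T>\<^sub>2 M) \<cdot> g))"
    unfolding univ by (rule cmp_vec_add[OF fib' pr(1)])
  finally show "vec_add M a b \<cdot> g = vec_add N (a \<cdot> g) (b \<cdot> g)"
    by (simp only: legs)
  have "a \<cdot> g \<cdot> \<^bold>p N = ?w \<cdot> (leg1 (\<T>\<^sub>2 M) \<cdot> g \<cdot> \<^bold>p N)" "b \<cdot> g \<cdot> \<^bold>p N = ?w \<cdot> (leg2 (\<T>\<^sub>2 M) \<cdot> g \<cdot> \<^bold>p N)"
    unfolding legs[symmetric] using pr(1) M N g by (auto simp: hom_def assoc)
  then show "same_fibre A N (a \<cdot> g) (b \<cdot> g)"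
    using ab g N fib by (auto simp: same_fibre_def hom_def)
qed

lemma tarr_vec_add:
  assumes f: "f \<in> hom X M N" and ab: "same_fibre A M a b"
  shows "vec_add M a b \<cdot> \<T> f = vec_add N (a \<cdot> \<T> f) (b \<cdot> \<T> f)"
proof -
  have obs: "M \<in> obj X" "N \<in> obj X" "f \<in> arr X" "src X f = M" "trg X f = N" using homD[OF f] by auto
  note two_legs_square[OF obs(1)]
  then have "leg1 (\<T>\<^sub>2 M) \<cdot> (\<^bold>p M \<cdot> f) = leg2 (\<T>\<^sub>2 M) \<cdot> (\<^bold>p M \<cdot> f)"
    using obs by (intro rewrite_prefix) auto
  then have "leg1 (\<T>\<^sub>2 M) \<cdot> \<T> f \<cdot> \<^bold>p N = leg2 (\<T>\<^sub>2 M) \<cdot> \<T> f \<cdot> \<^bold>p N"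
    using obs prj_natural[OF f] by (auto simp: assoc)
  then show ?thesis
    by (intro preserves_vec_addI(1)[OF obs(1,2) tarr_hom[OF f] _ _ ab])
      (simp_all add: vec_add_def sum_natural[OF f])
qed

text \<open>
  The tangent structure gives additivity of the lift only for the sum \<open>T s\<close>. The other sum on
  \<open>T (T M)\<close>, over \<open>T M\<close> along \<open>p\<close>, is the one that is natural for maps of the form \<open>T e\<close>.
\<close>

lemma lft_vec_add:
  assumes ab: "same_fibre A M a b"
  shows "vec_add M a b \<cdot> \<^bold>l M = vec_add (\<T>\<^sub>o M) (a \<cdot> \<^bold>l M) (b \<cdot> \<^bold>l M)"
    and "same_fibre A (\<T>\<^sub>o M) (a \<cdot> \<^bold>l M) (b \<cdot> \<^bold>l M)"
proof -
  have M: "M \<in> obj X" using ab by (auto simp: same_fibre_def)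
  let ?l1 = "leg1 (\<T>\<^sub>2 M)" and ?l2 = "leg2 (\<T>\<^sub>2 M)"
  let ?w = "pair X (tspan X (\<T>\<^sub>2 M)) (?l1 \<cdot> \<^bold>l M) (?l2 \<cdot> \<^bold>l M)"
  have pz: "?l1 \<cdot> (\<^bold>p M \<cdot> \<^bold>z M) = ?l2 \<cdot> (\<^bold>p M \<cdot> \<^bold>z M)"
    using two_legs_square[OF M] M by (intro rewrite_prefix) auto
  have pr: "?w \<in> hom X (apex (\<T>\<^sub>2 M)) (\<T>\<^sub>o (apex (\<T>\<^sub>2 M)))"
    "?w \<cdot> \<T> ?l1 = ?l1 \<cdot> \<^bold>l M" "?w \<cdot> \<T> ?l2 = ?l2 \<cdot> \<^bold>l M"
    using pair_into_pullback[OF Ttwo_pb[OF M], of "?l1 \<cdot> \<^bold>l M" "apex (\<T>\<^sub>2 M)" "?l2 \<cdot> \<^bold>l M"] M pz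
    by (auto simp: hom_def assoc lft_tprj)
  have wc: "?w \<cdot> (\<T> ?l1 \<cdot> \<^bold>c M) = ?l1 \<cdot> \<^bold>l M" "?w \<cdot> (\<T> ?l2 \<cdot> \<^bold>c M) = ?l2 \<cdot> \<^bold>l M"
    using pr M assoc[of ?w "\<T> ?l1" "\<^bold>c M"] assoc[of ?w "\<T> ?l2" "\<^bold>c M"]
    by (auto simp: hom_def assoc lft_flp)
  have Tp: "\<T> ?l1 \<cdot> \<T> (\<^bold>p M) = \<T> ?l2 \<cdot> \<T> (\<^bold>p M)"
    using two_legs_square[OF M] M by (simp flip: tarr_composite)
  have fibc: "same_fibre (\<T>\<^sub>o (apex (\<T>\<^sub>2 M))) (\<T>\<^sub>o M) (\<T> ?l1 \<cdot> \<^bold>c M) (\<T> ?l2 \<cdot> \<^bold>c M)"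
    using M Tp by (auto simp: same_fibre_def hom_def assoc flp_prj)
  \<comment> \<open>The flip fixes the lift and turns the sum \<open>T s\<close> into the sum along \<open>p\<close>.\<close>
  have sl: "\<^bold>s M \<cdot> \<^bold>l M = ?w \<cdot> \<T> (\<^bold>s M)"
    using lft_additive[OF M] by (simp add: additive_morphism_def tangent_abundle_def tabundle_def)
  have "\<^bold>s M \<cdot> \<^bold>l M = \<^bold>s M \<cdot> \<^bold>l M \<cdot> \<^bold>c M"
    using M by (simp add: assoc lft_flp)
  also have "\<dots> = ?w \<cdot> (\<T> (\<^bold>s M) \<cdot> \<^bold>c M)"
    unfolding sl using pr(1) M by (auto simp: hom_def assoc)
  also have "\<T> (\<^bold>s M) \<cdot> \<^bold>c M = vec_add (\<T>\<^sub>o M) (\<T> ?l1 \<cdot> \<^bold>c M) (\<T> ?l2 \<cdot> \<^bold>c M)"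
    using flp_additive[OF M]
    by (simp add: additive_morphism_def tangent_abundle_def tabundle_def vec_add_def)
  also have "?w \<cdot> \<dots> = vec_add (\<T>\<^sub>o M) (?l1 \<cdot> \<^bold>l M) (?l2 \<cdot> \<^bold>l M)"
    using cmp_vec_add[OF fibc pr(1)] by (simp add: wc)
  finally have univ: "\<^bold>s M \<cdot> \<^bold>l M = vec_add (\<T>\<^sub>o M) (?l1 \<cdot> \<^bold>l M) (?l2 \<cdot> \<^bold>l M)" .
  have fib: "?l1 \<cdot> \<^bold>l M \<cdot> \<^bold>p (\<T>\<^sub>o M) = ?l2 \<cdot> \<^bold>l M \<cdot> \<^bold>p (\<T>\<^sub>o M)"
    using M pz by (simp add: assoc lft_prj)
  show "vec_add M a b \<cdot> \<^bold>l M = vec_add (\<T>\<^sub>o M) (a \<cdot> \<^bold>l M) (b \<cdot> \<^bold>l M)"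
    "same_fibre A (\<T>\<^sub>o M) (a \<cdot> \<^bold>l M) (b \<cdot> \<^bold>l M)"
    using preserves_vec_addI[OF M tobj_obj[OF M] lft_hom[OF M] fib univ ab] by auto
qed


section \<open>Linear maps are additive\<close>

text \<open>
  Universality of the lift: \<open>l = \<langle>1, p z\<rangle> \<xi>\<close>, and \<open>\<xi>\<close> together with the base point is a pullback
  cone, so \<open>a l\<close> and the base point of \<open>a\<close> determine \<open>a\<close>; the base point is itself determined by
  \<open>a l\<close> through \<open>a l (T p) p = a p\<close>.
\<close>

lemma lft_monic:
  assumes M: "M \<in> obj X" and a: "a \<in> hom X A (\<T>\<^sub>o M)" and b: "b \<in> hom X A (\<T>\<^sub>o M)"
    and eq: "a \<cdot> \<^bold>l M = b \<cdot> \<^bold>l M"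
  shows "a = b"
proof -
  let ?l1 = "leg1 (\<T>\<^sub>2 M)" and ?l2 = "leg2 (\<T>\<^sub>2 M)"
  let ?d = "pair X (\<T>\<^sub>2 M) (\<one> (\<T>\<^sub>o M)) (\<^bold>p M \<cdot> \<^bold>z M)"
  let ?w = "pair X (tspan X (\<T>\<^sub>2 M)) (?l1 \<cdot> \<^bold>l M) (?l2 \<cdot> \<^bold>z (\<T>\<^sub>o M))"
  have fib: "same_fibre (\<T>\<^sub>o M) M (\<one> (\<T>\<^sub>o M)) (\<^bold>p M \<cdot> \<^bold>z M)"
    using M by (auto simp: same_fibre_def assoc zer_prj intro!: homI)
  note d = same_fibre_pair[OF fib]
  have dd: "?d \<in> arr X" "src X ?d = \<T>\<^sub>o M" "trg X ?d = apex (\<T>\<^sub>2 M)"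
    using d(1) by (auto simp: hom_def)
  have zz: "\<^bold>z M \<cdot> \<^bold>z (\<T>\<^sub>o M) = \<^bold>z M \<cdot> \<T> (\<^bold>z M)" using zer_natural[OF zer_hom[OF M]] .
  have zp: "\<^bold>z (\<T>\<^sub>o M) \<cdot> \<T> (\<^bold>p M) = \<^bold>p M \<cdot> \<^bold>z M" using zer_natural[OF prj_hom[OF M]] by simp
  have "?l1 \<cdot> (\<^bold>p M \<cdot> \<^bold>z M) = ?l2 \<cdot> (\<^bold>p M \<cdot> \<^bold>z M)"
    using two_legs_square[OF M] M by (intro rewrite_prefix) auto
  then have w_eq: "?l1 \<cdot> \<^bold>l M \<cdot> \<T> (\<^bold>p M) = ?l2 \<cdot> \<^bold>z (\<T>\<^sub>o M) \<cdot> \<T> (\<^bold>p M)"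
    using M by (simp add: assoc lft_tprj zp)
  have wh: "?w \<in> hom X (apex (\<T>\<^sub>2 M)) (\<T>\<^sub>o (apex (\<T>\<^sub>2 M)))"
    using pair_into_pullback(1)[OF Ttwo_pb[OF M] _ _ w_eq] M by (auto simp: hom_def)
  have d1: "?d \<cdot> (?l1 \<cdot> \<^bold>l M) = \<^bold>l M"
    using d dd M assoc[of ?d ?l1 "\<^bold>l M"] by simp
  have d2: "?d \<cdot> (?l2 \<cdot> \<^bold>z (\<T>\<^sub>o M)) = \<^bold>l M \<cdot> \<T> (\<^bold>p M \<cdot> \<^bold>z M)"
  proof -
    have "?d \<cdot> (?l2 \<cdot> \<^bold>z (\<T>\<^sub>o M)) = \<^bold>p M \<cdot> (\<^bold>z M \<cdot> \<^bold>z (\<T>\<^sub>o M))"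
      using d dd M assoc[of ?d ?l2 "\<^bold>z (\<T>\<^sub>o M)"] by (simp add: assoc)
    also have "\<dots> = (\<^bold>l M \<cdot> \<T> (\<^bold>p M)) \<cdot> \<T> (\<^bold>z M)"
      using M by (simp add: zz lft_tprj assoc)
    finally show ?thesis using M by (simp add: assoc tarr_composite)
  qed
  have "?d \<cdot> ?w = pair X (tspan X (\<T>\<^sub>2 M)) (?d \<cdot> (?l1 \<cdot> \<^bold>l M)) (?d \<cdot> (?l2 \<cdot> \<^bold>z (\<T>\<^sub>o M)))"
    using M by (intro cmp_pair[OF Ttwo_pb[OF M] _ _ w_eq d(1)]) (auto simp: hom_def)
  also have "\<dots> = \<^bold>l M \<cdot> \<T> ?d"
  proof -
    have "\<^bold>l M \<cdot> \<T> ?d \<in> hom X (\<T>\<^sub>o M) (apex (tspan X (\<T>\<^sub>2 M)))"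
      using dd M by (simp add: hom_def)
    from pair_unique[OF Ttwo_pb[OF M] this]
    show ?thesis using d dd M unfolding d1 d2 by (simp add: assoc tarr_idt flip: tarr_composite)
  qed
  finally have dw: "?d \<cdot> ?w = \<^bold>l M \<cdot> \<T> ?d" .
  have ds: "?d \<cdot> \<^bold>s M = \<one> (\<T>\<^sub>o M)"
    using vec_add_zero(1)[OF M idt_hom] M by (simp add: vec_add_def)
  have xi: "?d \<cdot> xi X M = \<^bold>l M"
  proof -
    have "?d \<cdot> xi X M = (?d \<cdot> ?w) \<cdot> \<T> (\<^bold>s M)"
      unfolding xi_def using wh dd M by (subst assoc) (auto simp: hom_def)
    also have "\<dots> = \<^bold>l M \<cdot> \<T> (?d \<cdot> \<^bold>s M)"
      unfolding dw using dd M by (simp add: assoc tarr_composite)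
    finally show ?thesis using M by (simp add: ds tarr_idt)
  qed
  have xih: "xi X M \<in> arr X" "src X (xi X M) = apex (\<T>\<^sub>2 M)" "trg X (xi X M) = \<T>\<^sub>o (\<T>\<^sub>o M)"
    using wh M by (auto simp: xi_def hom_def)
  have base: "c \<cdot> \<^bold>l M \<cdot> (\<T> (\<^bold>p M) \<cdot> \<^bold>p M) = c \<cdot> \<^bold>p M"
    if "c \<in> hom X A (\<T>\<^sub>o M)" for c
  proof -
    have "c \<cdot> \<^bold>l M \<cdot> (\<T> (\<^bold>p M) \<cdot> \<^bold>p M) = c \<cdot> ((\<^bold>l M \<cdot> \<T> (\<^bold>p M)) \<cdot> \<^bold>p M)"
      using that M by (auto simp: hom_def assoc)
    also have "\<dots> = c \<cdot> \<^bold>p M"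
      unfolding lft_tprj[OF M] using that M by (auto simp: hom_def assoc zer_prj)
    finally show ?thesis .
  qed
  have ab: "a \<cdot> \<^bold>p M = b \<cdot> \<^bold>p M"
    using base[OF a] base[OF b] eq by simp
  note pb = tangent_pullback_pullback[OF lft_universal[OF M]]
  have "a \<cdot> ?d = b \<cdot> ?d"
  proof (rule pullback_jointly_monic[OF pb, of _ A])
    have dlp: "?d \<cdot> (?l1 \<cdot> \<^bold>p M) = \<^bold>p M"
      using d dd M assoc[of ?d ?l1 "\<^bold>p M"] by simp
    show "a \<cdot> ?d \<in> hom X A (apex \<lparr>apex = apex (\<T>\<^sub>2 M), leg1 = xi X M, leg2 = ?l1 \<cdot> \<^bold>p M\<rparr>)"
      "b \<cdot> ?d \<in> hom X A (apex \<lparr>apex = apex (\<T>\<^sub>2 M), leg1 = xi X M, leg2 = ?l1 \<cdot> \<^bold>p M\<rparr>)"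
      using a b dd by (auto simp: hom_def)
    show "a \<cdot> ?d \<cdot> leg1 \<lparr>apex = apex (\<T>\<^sub>2 M), leg1 = xi X M, leg2 = ?l1 \<cdot> \<^bold>p M\<rparr> =
          b \<cdot> ?d \<cdot> leg1 \<lparr>apex = apex (\<T>\<^sub>2 M), leg1 = xi X M, leg2 = ?l1 \<cdot> \<^bold>p M\<rparr>"
      using a b dd xih eq by (auto simp: hom_def assoc xi)
    show "a \<cdot> ?d \<cdot> leg2 \<lparr>apex = apex (\<T>\<^sub>2 M), leg1 = xi X M, leg2 = ?l1 \<cdot> \<^bold>p M\<rparr> =
          b \<cdot> ?d \<cdot> leg2 \<lparr>apex = apex (\<T>\<^sub>2 M), leg1 = xi X M, leg2 = ?l1 \<cdot> \<^bold>p M\<rparr>"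
      using a b dd M ab by (auto simp: hom_def assoc dlp)
  qed
  then have "a \<cdot> ?d \<cdot> ?l1 = b \<cdot> ?d \<cdot> ?l1" by simp
  then show ?thesis using a b dd d M by (auto simp: hom_def assoc)
qed

text \<open>
  With \<open>e l = l (T e)\<close>, a sum followed by \<open>e\<close> and then \<open>l\<close> can be computed by letting first \<open>l\<close> and
  then \<open>T e\<close> pass through the sum; monicity of \<open>l\<close> removes the lift again.
\<close>

lemma linear_imp_additive:
  assumes M: "M \<in> obj X" and e: "e \<in> hom X (\<T>\<^sub>o M) (\<T>\<^sub>o M)"
    and over: "e \<cdot> \<^bold>p M = \<^bold>p M" and lin: "e \<cdot> \<^bold>l M = \<^bold>l M \<cdot> \<T> e"
    and ab: "same_fibre A M a b"
  shows "vec_add M a b \<cdot> e = vec_add M (a \<cdot> e) (b \<cdot> e)"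
proof (rule lft_monic[OF M, of _ A])
  have ar: "a \<in> arr X" "src X a = A" "trg X a = \<T>\<^sub>o M" "b \<in> arr X" "src X b = A" "trg X b = \<T>\<^sub>o M"
    "e \<in> arr X" "src X e = \<T>\<^sub>o M" "trg X e = \<T>\<^sub>o M"
    using ab e by (auto simp: same_fibre_def hom_def)
  have ab': "same_fibre A M (a \<cdot> e) (b \<cdot> e)"
    using ab ar over M by (auto simp: same_fibre_def hom_def assoc)
  note sum = vec_add_hom[OF ab]
  show "vec_add M a b \<cdot> e \<in> hom X A (\<T>\<^sub>o M)" by (rule cmp_hom[OF sum e])
  show "vec_add M (a \<cdot> e) (b \<cdot> e) \<in> hom X A (\<T>\<^sub>o M)" by (rule vec_add_hom[OF ab'])
  have al: "a \<cdot> \<^bold>l M \<cdot> \<T> e = a \<cdot> e \<cdot> \<^bold>l M" "b \<cdot> \<^bold>l M \<cdot> \<T> e = b \<cdot> e \<cdot> \<^bold>l M"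
    using ar M lin by (simp_all add: assoc)
  have "vec_add M a b \<cdot> e \<cdot> \<^bold>l M = vec_add M a b \<cdot> \<^bold>l M \<cdot> \<T> e"
    using sum ar M lin by (auto simp: hom_def assoc)
  also have "\<dots> = vec_add (\<T>\<^sub>o M) (a \<cdot> \<^bold>l M) (b \<cdot> \<^bold>l M) \<cdot> \<T> e"
    by (simp only: lft_vec_add(1)[OF ab])
  also have "\<dots> = vec_add (\<T>\<^sub>o M) (a \<cdot> e \<cdot> \<^bold>l M) (b \<cdot> e \<cdot> \<^bold>l M)"
    unfolding tarr_vec_add[OF e lft_vec_add(2)[OF ab]] al ..
  also have "\<dots> = vec_add M (a \<cdot> e) (b \<cdot> e) \<cdot> \<^bold>l M"
    by (rule lft_vec_add(1)[OF ab', symmetric])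
  finally show "vec_add M a b \<cdot> e \<cdot> \<^bold>l M = vec_add M (a \<cdot> e) (b \<cdot> e) \<cdot> \<^bold>l M" .
qed

end


section \<open>The vertical bundle\<close>

locale vertical_bundle_of = tangent_category X for X :: "('o, 'm) tangent" (structure) +
  fixes q :: 'm and V :: "('o, 'm) span"
  assumes q_arr: "q \<in> arr X"
    and V_pb: "tangent_pullback X V (\<T> q) (\<^bold>z (trg X q))"
begin

abbreviation "E \<equiv> src X q"
abbreviation "M \<equiv> trg X q"
abbreviation "\<iota> \<equiv> leg1 V"
abbreviation "\<tau> \<equiv> leg2 V"
abbreviation "zV \<equiv> zero (vertical_bundle X q V)"
abbreviation "lV \<equiv> lift (vertical_bundle X q V)"

lemma E_obj [simp]: "E \<in> obj X" and M_obj [simp]: "M \<in> obj X" and q_arr' [simp]: "q \<in> arr X"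
  using q_arr src_obj trg_obj by auto

lemma V_legs [simp]:
  "\<iota> \<in> arr X" "src X \<iota> = apex V" "trg X \<iota> = \<T>\<^sub>o E"
  "\<tau> \<in> arr X" "src X \<tau> = apex V" "trg X \<tau> = M" "apex V \<in> obj X"
  using pullback_square[OF tangent_pullback_pullback[OF V_pb]] by auto

lemma V_square: "\<iota> \<cdot> \<T> q = \<tau> \<cdot> \<^bold>z M"
  using pullback_square(11)[OF tangent_pullback_pullback[OF V_pb]] .

lemma V_base: "\<tau> = \<iota> \<cdot> (\<^bold>p E \<cdot> q)"
proof -
  have "\<tau> = (\<tau> \<cdot> \<^bold>z M) \<cdot> \<^bold>p M" by (simp add: assoc zer_prj)
  also have "\<dots> = \<iota> \<cdot> (\<T> q \<cdot> \<^bold>p M)" by (simp add: assoc flip: V_square)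
  also have "\<T> q \<cdot> \<^bold>p M = \<^bold>p E \<cdot> q" using prj_natural[of q E M] by (simp add: hom_def)
  finally show ?thesis .
qed

text \<open>The second leg factors through \<open>\<iota>\<close>, so joint monicity of the legs makes \<open>\<iota>\<close> monic.\<close>

lemma iota_monic:
  assumes "a \<in> hom X A (apex V)" "b \<in> hom X A (apex V)" and eq: "a \<cdot> \<iota> = b \<cdot> \<iota>"
  shows "a = b"
proof -
  have "a \<cdot> \<tau> = b \<cdot> \<tau>"
    unfolding V_base using assms(1,2) by (intro rewrite_prefix[OF eq]) (auto simp: hom_def)
  then show ?thesis
    using pullback_jointly_monic[OF tangent_pullback_pullback[OF V_pb] assms(1,2) eq] by simp
qed

lemma T_iota_monic:
  assumes "a \<in> hom X A (\<T>\<^sub>o (apex V))" "b \<in> hom X A (\<T>\<^sub>o (apex V))" and eq: "a \<cdot> \<T> \<iota> = b \<cdot> \<T> \<iota>"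
  shows "a = b"
proof -
  have "\<T> \<tau> = \<T> \<iota> \<cdot> \<T> (\<^bold>p E \<cdot> q)"
    by (subst V_base) (simp add: tarr_composite)
  moreover have "a \<cdot> (\<T> \<iota> \<cdot> \<T> (\<^bold>p E \<cdot> q)) = b \<cdot> (\<T> \<iota> \<cdot> \<T> (\<^bold>p E \<cdot> q))"
    using assms(1,2) by (intro rewrite_prefix[OF eq]) (auto simp: hom_def)
  ultimately have "a \<cdot> \<T> \<tau> = b \<cdot> \<T> \<tau>" by simp
  then show ?thesis
    using pullback_jointly_monic[OF tangent_pullback_tspan[OF V_pb], of a A b] assms by simp
qed

lemma zV: "zV \<in> hom X E (apex V)" "zV \<cdot> \<iota> = \<^bold>z E"
proof -
  have "\<^bold>z E \<cdot> \<T> q = q \<cdot> \<^bold>z M" using zer_natural[of q E M] by (simp add: hom_def)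
  then obtain f where f: "f \<in> hom X E (apex V)" "f \<cdot> \<iota> = \<^bold>z E"
    using pair_into_pullback[OF tangent_pullback_pullback[OF V_pb], of "\<^bold>z E" E q]
    by (auto simp: hom_def)
  then have "\<exists>!f. f \<in> hom X E (apex V) \<and> f \<cdot> \<iota> = \<^bold>z E"
    using iota_monic by metis
  from theI'[OF this] show "zV \<in> hom X E (apex V)" "zV \<cdot> \<iota> = \<^bold>z E"
    by (simp_all add: vertical_bundle_def Let_def)
qed

lemma lV: "lV \<in> hom X (apex V) (\<T>\<^sub>o (apex V))" "lV \<cdot> \<T> \<iota> = \<iota> \<cdot> \<^bold>l E"
proof -
  have "\<iota> \<cdot> \<^bold>l E \<cdot> \<T> (\<T> q) = \<iota> \<cdot> (\<T> q \<cdot> \<^bold>l M)"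
    using lft_natural[of q E M] by (simp add: hom_def assoc)
  also have "\<dots> = \<tau> \<cdot> \<^bold>z M \<cdot> \<^bold>l M" by (simp add: assoc flip: V_square)
  also have "\<dots> = \<tau> \<cdot> \<^bold>z M \<cdot> \<T> (\<^bold>z M)" by (simp add: assoc zer_lft)
  finally have sq: "\<iota> \<cdot> \<^bold>l E \<cdot> \<T> (\<T> q) = \<tau> \<cdot> \<^bold>z M \<cdot> \<T> (\<^bold>z M)" .
  obtain f where f: "f \<in> hom X (apex V) (\<T>\<^sub>o (apex V))" "f \<cdot> \<T> \<iota> = \<iota> \<cdot> \<^bold>l E"
    using pair_into_pullback[OF tangent_pullback_tspan[OF V_pb] _ _ sq, of "apex V"]
    by (auto simp: hom_def)
  then have "\<exists>!f. f \<in> hom X (apex V) (\<T>\<^sub>o (apex V)) \<and> f \<cdot> \<T> \<iota> = \<iota> \<cdot> \<^bold>l E"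
    using T_iota_monic by metis
  from theI'[OF this] show "lV \<in> hom X (apex V) (\<T>\<^sub>o (apex V))" "lV \<cdot> \<T> \<iota> = \<iota> \<cdot> \<^bold>l E"
    by (simp_all add: vertical_bundle_def Let_def)
qed

lemma zV_arr [simp]: "zV \<in> arr X" "src X zV = E" "trg X zV = apex V"
  and lV_arr [simp]: "lV \<in> arr X" "src X lV = apex V" "trg X lV = \<T>\<^sub>o (apex V)"
  using zV(1) lV(1) by (auto simp: hom_def)

lemma zV_base: "zV \<cdot> \<tau> = q"
proof -
  have "zV \<cdot> \<tau> = (zV \<cdot> \<iota>) \<cdot> (\<^bold>p E \<cdot> q)" by (subst V_base) (simp add: assoc)
  also have "\<dots> = (\<^bold>z E \<cdot> \<^bold>p E) \<cdot> q" by (simp add: zV(2) assoc)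
  finally show ?thesis by (simp add: zer_prj)
qed

text \<open>Inherited along the monic \<open>T \<iota>\<close> from \<open>z l = z (T z)\<close> on \<open>E\<close>.\<close>

lemma zV_lV: "zV \<cdot> lV = \<^bold>z E \<cdot> \<T> zV"
proof (rule T_iota_monic[of _ E])
  have "zV \<cdot> lV \<cdot> \<T> \<iota> = zV \<cdot> \<iota> \<cdot> \<^bold>l E" by (simp add: assoc lV(2))
  also have "\<dots> = \<^bold>z E \<cdot> \<T> (\<^bold>z E)" by (simp add: zV(2) zer_lft)
  also have "\<dots> = \<^bold>z E \<cdot> \<T> zV \<cdot> \<T> \<iota>" by (simp add: assoc zV(2) flip: tarr_composite)
  finally show "zV \<cdot> lV \<cdot> \<T> \<iota> = \<^bold>z E \<cdot> \<T> zV \<cdot> \<T> \<iota>" .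
qed (auto simp: hom_def)

end


section \<open>The horizontal connection of a full vertical connection\<close>

locale full_connection = vertical_bundle_of X q V
  for X :: "('o, 'm) tangent" (structure) and q V +
  fixes F :: "('o, 'm) span" and R :: 'm
  assumes F_pb: "tangent_pullback X F q (\<^bold>p (trg X q))"
    and full: "full_vertical_connection X q V R"
begin

abbreviation "qF \<equiv> leg1 F"
abbreviation "\<phi> \<equiv> leg2 F"
abbreviation "lF \<equiv> lift (finsler_bundle X q F)"
abbreviation "\<pi> \<equiv> horizontal_descent X q F"

lemma F_legs [simp]:
  "qF \<in> arr X" "src X qF = apex F" "trg X qF = E"
  "\<phi> \<in> arr X" "src X \<phi> = apex F" "trg X \<phi> = \<T>\<^sub>o M" "apex F \<in> obj X"
  using pullback_square[OF tangent_pullback_pullback[OF F_pb]] by auto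

lemma F_square: "qF \<cdot> q = \<phi> \<cdot> \<^bold>p M"
  using pullback_square(11)[OF tangent_pullback_pullback[OF F_pb]] .

lemma Tq_prj: "\<T> q \<cdot> \<^bold>p M = \<^bold>p E \<cdot> q"
  using prj_natural[of q E M] by (simp add: hom_def)

lemma descent:
  "\<pi> \<in> hom X (\<T>\<^sub>o E) (apex F)" "\<pi> \<cdot> qF = \<^bold>p E" "\<pi> \<cdot> \<phi> = \<T> q"
  using pair_into_pullback[OF tangent_pullback_pullback[OF F_pb], of "\<^bold>p E" "\<T>\<^sub>o E" "\<T> q"]
  unfolding horizontal_descent_def by (auto simp: hom_def Tq_prj)

lemma descent_arr [simp]: "\<pi> \<in> arr X" "src X \<pi> = \<T>\<^sub>o E" "trg X \<pi> = apex F"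
  using descent(1) by (auto simp: hom_def)

lemma lF: "lF \<in> hom X (apex F) (\<T>\<^sub>o (apex F))" "lF \<cdot> \<T> qF = qF \<cdot> \<^bold>z E" "lF \<cdot> \<T> \<phi> = \<phi> \<cdot> \<^bold>l M"
proof -
  have "qF \<cdot> \<^bold>z E \<cdot> \<T> q = qF \<cdot> (q \<cdot> \<^bold>z M)"
    using zer_natural[of q E M] by (simp add: hom_def assoc)
  also have "\<dots> = \<phi> \<cdot> (\<^bold>p M \<cdot> \<^bold>z M)" by (intro rewrite_prefix[OF F_square]) simp_all
  also have "\<dots> = \<phi> \<cdot> \<^bold>l M \<cdot> \<T> (\<^bold>p M)" by (simp add: assoc lft_tprj)
  finally have sq: "qF \<cdot> \<^bold>z E \<cdot> \<T> q = \<phi> \<cdot> \<^bold>l M \<cdot> \<T> (\<^bold>p M)" .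
  have "lF = pair X (tspan X F) (qF \<cdot> \<^bold>z E) (\<phi> \<cdot> \<^bold>l M)"
    by (simp add: finsler_bundle_def Let_def)
  with pair_into_pullback[OF tangent_pullback_tspan[OF F_pb] _ _ sq, of "apex F"]
  show "lF \<in> hom X (apex F) (\<T>\<^sub>o (apex F))" "lF \<cdot> \<T> qF = qF \<cdot> \<^bold>z E" "lF \<cdot> \<T> \<phi> = \<phi> \<cdot> \<^bold>l M"
    by (auto simp: hom_def)
qed

lemma lF_arr [simp]: "lF \<in> arr X" "src X lF = apex F" "trg X lF = \<T>\<^sub>o (apex F)"
  using lF(1) by (auto simp: hom_def)

lemma R_vertical: "vertical_connection X q V R"
  and R_pb: "tangent_pullback X \<lparr>apex = \<T>\<^sub>o E, leg1 = R, leg2 = \<T> q\<rparr> \<tau> (\<^bold>p M)"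
  using full by (auto simp: full_vertical_connection_def)

lemma R_arr [simp]: "R \<in> arr X" "src X R = \<T>\<^sub>o E" "trg X R = apex V"
  using R_vertical by (auto simp: vertical_connection_def hom_def)

lemma iota_R: "\<iota> \<cdot> R = \<one> (apex V)"
  using R_vertical by (simp add: vertical_connection_def)

lemma R_over: "R \<cdot> (\<iota> \<cdot> \<^bold>p E) = \<^bold>p E"
  and R_linear: "R \<cdot> lV = \<^bold>l E \<cdot> \<T> R"
  using R_vertical
  by (auto simp: vertical_connection_def linear_morphism_def tangent_bundle_def vertical_bundle_def
      Let_def)

lemma R_base: "R \<cdot> \<tau> = \<T> q \<cdot> \<^bold>p M"
  using pullback_square(11)[OF tangent_pullback_pullback[OF R_pb]] by simp

lemma R_Tq_monic:
  assumes "a \<in> hom X A (\<T>\<^sub>o E)" "b \<in> hom X A (\<T>\<^sub>o E)" "a \<cdot> R = b \<cdot> R" "a \<cdot> \<T> q = b \<cdot> \<T> q"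
  shows "a = b"
  using pullback_jointly_monic[OF tangent_pullback_pullback[OF R_pb]] assms by simp

lemma TR_TTq_monic:
  assumes "a \<in> hom X A (\<T>\<^sub>o (\<T>\<^sub>o E))" "b \<in> hom X A (\<T>\<^sub>o (\<T>\<^sub>o E))"
    "a \<cdot> \<T> R = b \<cdot> \<T> R" "a \<cdot> \<T> (\<T> q) = b \<cdot> \<T> (\<T> q)"
  shows "a = b"
  using pullback_jointly_monic[OF tangent_pullback_tspan[OF R_pb]] assms by simp

text \<open>
  Linearity of \<open>R\<close> into the vertical bundle becomes linearity of \<open>R \<iota>\<close> as an endomorphism of the
  tangent bundle, because the lift of the vertical bundle is the restriction of \<open>l\<close> along \<open>\<iota>\<close>.
\<close>

lemma vertical_part_add:
  assumes ab: "same_fibre A E a b"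
  shows "vec_add E a b \<cdot> (R \<cdot> \<iota>) = vec_add E (a \<cdot> (R \<cdot> \<iota>)) (b \<cdot> (R \<cdot> \<iota>))"
proof (rule linear_imp_additive[OF E_obj _ _ _ ab])
  show "R \<cdot> \<iota> \<in> hom X (\<T>\<^sub>o E) (\<T>\<^sub>o E)" by (simp add: hom_def)
  show "R \<cdot> \<iota> \<cdot> \<^bold>p E = \<^bold>p E" by (simp add: assoc R_over)
  have "R \<cdot> \<iota> \<cdot> \<^bold>l E = R \<cdot> lV \<cdot> \<T> \<iota>" by (simp add: assoc lV(2))
  also have "\<dots> = \<^bold>l E \<cdot> \<T> (R \<cdot> \<iota>)" by (simp add: R_linear assoc tarr_composite)
  finally show "R \<cdot> \<iota> \<cdot> \<^bold>l E = \<^bold>l E \<cdot> \<T> (R \<cdot> \<iota>)" .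
qed

definition H :: 'm where
  "H = pair X \<lparr>apex = \<T>\<^sub>o E, leg1 = R, leg2 = \<T> q\<rparr> (qF \<cdot> zV) \<phi>"

lemma H: "H \<in> hom X (apex F) (\<T>\<^sub>o E)" "H \<cdot> R = qF \<cdot> zV" "H \<cdot> \<T> q = \<phi>"
  using pair_into_pullback[OF tangent_pullback_pullback[OF R_pb], of "qF \<cdot> zV" "apex F" \<phi>]
  unfolding H_def by (auto simp: hom_def assoc zV_base F_square)

lemma H_arr [simp]: "H \<in> arr X" "src X H = apex F" "trg X H = \<T>\<^sub>o E"
  using H(1) by (auto simp: hom_def)

lemma H_over: "H \<cdot> \<^bold>p E = qF"
proof -
  have "H \<cdot> \<^bold>p E = (H \<cdot> R) \<cdot> (\<iota> \<cdot> \<^bold>p E)"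
    by (simp add: assoc R_over)
  also have "\<dots> = qF \<cdot> ((zV \<cdot> \<iota>) \<cdot> \<^bold>p E)"
    by (simp add: H(2) assoc)
  finally show ?thesis by (simp add: zV(2) zer_prj)
qed

lemma H_section: "H \<cdot> \<pi> = \<one> (apex F)"
proof (rule pullback_jointly_monic[OF tangent_pullback_pullback[OF F_pb], of _ "apex F"])
  show "H \<cdot> \<pi> \<cdot> qF = \<one> (apex F) \<cdot> qF" by (simp add: assoc descent H_over)
  show "H \<cdot> \<pi> \<cdot> \<phi> = \<one> (apex F) \<cdot> \<phi>" by (simp add: assoc descent H(3))
qed (simp_all add: hom_def)

text \<open>
  Both composites are compared on the jointly monic legs \<open>T R\<close> and \<open>T (T q)\<close>. On the first, linearity
  of \<open>R\<close> reduces the claim to the lift of a zero vector; on the second, naturality of \<open>l\<close> reduces it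
  to the definition of the Finsler lift.
\<close>

lemma H_linear: "H \<cdot> \<^bold>l E = lF \<cdot> \<T> H"
proof (rule TR_TTq_monic[of _ "apex F"])
  have "H \<cdot> \<^bold>l E \<cdot> \<T> R = (H \<cdot> R) \<cdot> lV" by (simp add: assoc R_linear)
  also have "\<dots> = (qF \<cdot> \<^bold>z E) \<cdot> \<T> zV" by (simp add: H(2) assoc zV_lV)
  also have "\<dots> = lF \<cdot> \<T> (H \<cdot> R)" by (simp add: assoc H(2) tarr_composite flip: lF(2))
  also have "\<dots> = lF \<cdot> \<T> H \<cdot> \<T> R" by (simp add: assoc tarr_composite)
  finally show "H \<cdot> \<^bold>l E \<cdot> \<T> R = lF \<cdot> \<T> H \<cdot> \<T> R" .
  have "H \<cdot> \<^bold>l E \<cdot> \<T> (\<T> q) = H \<cdot> \<T> q \<cdot> \<^bold>l M"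
    using lft_natural[of q E M] by (simp add: hom_def assoc)
  also have "\<dots> = lF \<cdot> \<T> (H \<cdot> \<T> q)" by (simp add: H(3) lF(3))
  also have "\<dots> = lF \<cdot> \<T> H \<cdot> \<T> (\<T> q)" by (simp add: assoc tarr_composite)
  finally show "H \<cdot> \<^bold>l E \<cdot> \<T> (\<T> q) = lF \<cdot> \<T> H \<cdot> \<T> (\<T> q)" .
qed (simp_all add: hom_def)

lemma H_horizontal: "horizontal_connection X q F H"
  unfolding horizontal_connection_def linear_morphism_def
  using H(1) H_section H_over H_linear
  by (simp add: tangent_bundle_def finsler_bundle_def Let_def idt_hom)

text \<open>
  The decomposition of a tangent vector of \<open>E\<close> into vertical and horizontal part is checked on the
  legs of the fullness pullback: \<open>T q\<close> sends the vertical part to zero, and \<open>R\<close> the horizontal part.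
\<close>

lemma vertical_plus_horizontal: "vec_add E (R \<cdot> \<iota>) (\<pi> \<cdot> H) = \<one> (\<T>\<^sub>o E)"
proof (rule R_Tq_monic[of _ "\<T>\<^sub>o E"])
  have fib: "same_fibre (\<T>\<^sub>o E) E (R \<cdot> \<iota>) (\<pi> \<cdot> H)"
    by (simp add: same_fibre_def hom_def assoc R_over H_over descent(2))
  have sum: "vec_add E (R \<cdot> \<iota>) (\<pi> \<cdot> H) \<in> arr X"
    "src X (vec_add E (R \<cdot> \<iota>) (\<pi> \<cdot> H)) = \<T>\<^sub>o E" "trg X (vec_add E (R \<cdot> \<iota>) (\<pi> \<cdot> H)) = \<T>\<^sub>o E"
    using vec_add_hom[OF fib] by (auto simp: hom_def)
  show "vec_add E (R \<cdot> \<iota>) (\<pi> \<cdot> H) \<in> hom X (\<T>\<^sub>o E) (\<T>\<^sub>o E)" "\<one> (\<T>\<^sub>o E) \<in> hom X (\<T>\<^sub>o E) (\<T>\<^sub>o E)"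
    using sum by (simp_all add: hom_def)

  have vv: "R \<cdot> \<iota> \<cdot> (R \<cdot> \<iota>) = R \<cdot> \<iota>"
    using rewrite_prefix[of \<iota> R "\<one> (apex V)" "\<one> (apex V)" \<iota>] by (simp add: assoc iota_R)
  have hv: "\<pi> \<cdot> H \<cdot> (R \<cdot> \<iota>) = R \<cdot> \<iota> \<cdot> (\<^bold>p E \<cdot> \<^bold>z E)"
  proof -
    have "\<pi> \<cdot> H \<cdot> (R \<cdot> \<iota>) = \<pi> \<cdot> (H \<cdot> R) \<cdot> \<iota>" by (simp add: assoc)
    also have "\<dots> = (\<pi> \<cdot> qF) \<cdot> (zV \<cdot> \<iota>)" by (simp add: H(2) assoc)
    also have "\<dots> = R \<cdot> (\<iota> \<cdot> \<^bold>p E) \<cdot> \<^bold>z E" by (simp add: descent(2) zV(2) R_over)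
    finally show ?thesis by (simp add: assoc)
  qed
  have "vec_add E (R \<cdot> \<iota>) (\<pi> \<cdot> H) \<cdot> R \<cdot> \<iota> = vec_add E (R \<cdot> \<iota>) (\<pi> \<cdot> H) \<cdot> (R \<cdot> \<iota>)"
    using sum by (simp add: assoc)
  also have "\<dots> = vec_add E (R \<cdot> \<iota>) (R \<cdot> \<iota> \<cdot> (\<^bold>p E \<cdot> \<^bold>z E))"
    by (simp only: vertical_part_add[OF fib] vv hv)
  also have "\<dots> = R \<cdot> \<iota>"
    by (rule vec_add_zero(1)[of _ _ "\<T>\<^sub>o E"]) (simp_all add: hom_def)
  finally have "vec_add E (R \<cdot> \<iota>) (\<pi> \<cdot> H) \<cdot> R = R"
    by (rule iota_monic[rotated 2, where A = "\<T>\<^sub>o E"]) (use sum in \<open>simp_all add: hom_def\<close>)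
  then show "vec_add E (R \<cdot> \<iota>) (\<pi> \<cdot> H) \<cdot> R = \<one> (\<T>\<^sub>o E) \<cdot> R" by simp

  have vq: "R \<cdot> \<iota> \<cdot> \<T> q = \<T> q \<cdot> (\<^bold>p M \<cdot> \<^bold>z M)"
  proof -
    have "R \<cdot> \<iota> \<cdot> \<T> q = (R \<cdot> \<tau>) \<cdot> \<^bold>z M" by (simp add: assoc V_square)
    then show ?thesis by (simp add: R_base assoc)
  qed
  have hq: "\<pi> \<cdot> H \<cdot> \<T> q = \<T> q" by (simp add: assoc H(3) descent(3))
  have "vec_add E (R \<cdot> \<iota>) (\<pi> \<cdot> H) \<cdot> \<T> q = vec_add M (\<T> q \<cdot> (\<^bold>p M \<cdot> \<^bold>z M)) (\<T> q)"
    using tarr_vec_add[OF _ fib, of q M] by (simp add: hom_def vq hq)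
  also have "\<dots> = \<T> q"
    by (rule vec_add_zero(2)[of _ _ "\<T>\<^sub>o E"]) (simp_all add: hom_def)
  finally show "vec_add E (R \<cdot> \<iota>) (\<pi> \<cdot> H) \<cdot> \<T> q = \<one> (\<T>\<^sub>o E) \<cdot> \<T> q" by simp
qed

lemma H_ehresmann: "ehresmann_connection X q V F R H"
  unfolding ehresmann_connection_def
  using R_vertical H_horizontal H(2) vertical_plus_horizontal by (simp add: vec_add_def)

text \<open>
  A section \<open>K\<close> of the horizontal descent \<open>\<pi>\<close> satisfies \<open>K (T q) = K \<pi> \<phi> = \<phi>\<close>, so by fullness \<open>K R\<close>
  determines it.
\<close>

lemma horizontal_unique:
  assumes "horizontal_connection X q F K" and KR: "K \<cdot> R = qF \<cdot> zV"
  shows "K = H"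
proof (rule R_Tq_monic[of _ "apex F"])
  have K: "K \<in> hom X (apex F) (\<T>\<^sub>o E)" and sec: "K \<cdot> \<pi> = \<one> (apex F)"
    using assms(1) by (auto simp: horizontal_connection_def)
  show "K \<in> hom X (apex F) (\<T>\<^sub>o E)" "H \<in> hom X (apex F) (\<T>\<^sub>o E)" by (fact K, fact H(1))
  show "K \<cdot> R = H \<cdot> R" by (simp add: KR H(2))
  have "K \<cdot> \<T> q = (K \<cdot> \<pi>) \<cdot> \<phi>"
    using K by (auto simp: hom_def assoc descent(3))
  then show "K \<cdot> \<T> q = H \<cdot> \<T> q" by (simp add: sec H(3))
qed

end

theorem proposition3p28:
  fixes X :: "('o, 'm) tangent"
    and V F :: "('o, 'm) span"
    and q R :: 'm
  assumes "tangent_category X"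
    and "tangent_display_map X q"
    and "vertical_pullback X q V"
    and "finsler_pullback X q F"
    and "full_vertical_connection X q V R"
  shows "\<exists>!H. horizontal_connection X q F H \<and> ehresmann_connection X q V F R H"
proof -
  interpret tangent_category X by fact
  have "q \<in> arr X" using assms(2) by (simp add: tangent_display_map_def)
  then interpret full_connection X q V F R
    using assms(3-5)
    by unfold_locales (simp_all add: vertical_pullback_def finsler_pullback_def)
  show ?thesis
  proof (intro ex1I conjI)
    show "horizontal_connection X q F H" "ehresmann_connection X q V F R H"
      by (fact H_horizontal, fact H_ehresmann)
    show "K = H" if "horizontal_connection X q F K \<and> ehresmann_connection X q V F R K" for K
      using that by (intro horizontal_unique) (auto simp: ehresmann_connection_def)
  qed
qed

end
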